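(* Let $p,m,n$ be positive integers with $p>m$, $n>m^2$ and $n\ge17$, and let $d\ge 64\,p\,m^{\frac m2+2}\,4.67^m$. Consider ReLU networks $s^\theta(x)=V\,\mathrm{ReLU}(Wx)$, $\theta=(W,V)\in\mathbb{R}^{d\times p}\times\mathbb{R}^{p\times d}$. Fix $\delta\in(0,1)$ and a constant $c>0$. With probability at least $1-\delta$ over $\mathcal{D}_{\mathrm{train}}\sim\mathcal{D}_m^n$, every interpolating $\theta$ whose normalized margin satisfies \[ \overline{\gamma}_{\theta,\mathrm{ReLU}}:=\frac{\gamma_\theta(\mathcal{D}_{\mathrm{train}})}{\|V\|_2\|W\|_F}\ \ge\ c\cdot\frac{1}{\sqrt p}\cdot\frac{1}{m^{1.5m+2.5}\,6.34^m} \] obeys \[ \mathbb{P}_{(X,Y)\sim\mathcal{D}_m}\big[h_\theta(X)\ne Y\big]\ \le\ \widetilde{\mathcal{O}}\!\left(p\,m^{1.5m+2.5}\,6.34^m\sqrt{\frac mn}\right), \] where $\widetilde{\mathcal{O}}(\cdot)$ hides constants depending only on $c$ and polylogarithmic factors in $n$ and $\delta^{-1}$.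
   Context: Let $[p]=\{0,\dots,p-1\}$, $e_r$ the standard basis of $\mathbb{R}^p$, $\mathcal{X}_m=\{x\in\{0,\dots,m\}^p:\|x\|_1=m\}$. $\mathcal{D}_m$ is the law of $(X,Y)$ with $s_1,\dots,s_m$ i.i.d. uniform on $[p]$, $X=\sum_i e_{s_i}$, $Y=(\sum_i s_i)\bmod p$; $\mathcal{D}_{\mathrm{train}}=\{(x^{(i)},y^{(i)})\}_{i=1}^n$ consists of $n$ i.i.d. draws. $\mathrm{ReLU}(t)=\max\{0,t\}$ entrywise. The predictor is $h_\theta(x)=\ell$ if $s^\theta_\ell(x)>s^\theta_k(x)$ for all $k\ne\ell$, and $\bot$ (an error) otherwise. The margin of $(x,y)$ is $\gamma_\theta(x,y)=s^\theta_y(x)-\max_{k\ne y}s^\theta_k(x)$, $\gamma_\theta(\mathcal{D}_{\mathrm{train}})=\min_i\gamma_\theta(x^{(i)},y^{(i)})$, and $\theta$ is interpolating if $\gamma_\theta(\mathcal{D}_{\mathrm{train}})>0$. $\|V\|_2$ is the spectral norm and $\|W\|_F$ the Frobenius norm. *)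

theory Defs
  imports "HOL-Probability.Probability"
begin

text \<open>Vectors in R^p are functions nat => real (only indices < p matter);
  a d x p matrix W is a function nat => nat => real, entry W j r (j < d, r < p).\<close>

definition relu :: "real \<Rightarrow> real" where
  "relu t = max 0 t"

text \<open>The data distribution D_m: s_1..s_m iid uniform on [p], X = sum of e_(s_i), Y = (sum s_i) mod p.\<close>
definition data_dist :: "nat \<Rightarrow> nat \<Rightarrow> ((nat \<Rightarrow> real) \<times> nat) pmf" where
  "data_dist p m = map_pmf (\<lambda>s. (\<lambda>r. real (count_list s r), sum_list s mod p))
                     (replicate_pmf m (pmf_of_set {..<p}))"

definition train_dist :: "nat \<Rightarrow> nat \<Rightarrow> nat \<Rightarrow> ((nat \<Rightarrow> real) \<times> nat) list pmf" where
  "train_dist p m n = replicate_pmf n (data_dist p m)"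

definition score :: "nat \<Rightarrow> nat \<Rightarrow> (nat \<Rightarrow> nat \<Rightarrow> real) \<Rightarrow> (nat \<Rightarrow> nat \<Rightarrow> real)
                      \<Rightarrow> (nat \<Rightarrow> real) \<Rightarrow> nat \<Rightarrow> real" where
  "score p d W V x k = (\<Sum>j<d. V k j * relu (\<Sum>r<p. W j r * x r))"

definition predict :: "nat \<Rightarrow> nat \<Rightarrow> (nat \<Rightarrow> nat \<Rightarrow> real) \<Rightarrow> (nat \<Rightarrow> nat \<Rightarrow> real)
                      \<Rightarrow> (nat \<Rightarrow> real) \<Rightarrow> nat option" where
  "predict p d W V x =
     (if \<exists>l<p. \<forall>k<p. k \<noteq> l \<longrightarrow> score p d W V x l > score p d W V x k
      then Some (THE l. l < p \<and> (\<forall>k<p. k \<noteq> l \<longrightarrow> score p d W V x l > score p d W V x k))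
      else None)"

definition margin :: "nat \<Rightarrow> nat \<Rightarrow> (nat \<Rightarrow> nat \<Rightarrow> real) \<Rightarrow> (nat \<Rightarrow> nat \<Rightarrow> real)
                      \<Rightarrow> (nat \<Rightarrow> real) \<Rightarrow> nat \<Rightarrow> real" where
  "margin p d W V x y = score p d W V x y - Max {score p d W V x k | k. k < p \<and> k \<noteq> y}"

definition train_margin :: "nat \<Rightarrow> nat \<Rightarrow> (nat \<Rightarrow> nat \<Rightarrow> real) \<Rightarrow> (nat \<Rightarrow> nat \<Rightarrow> real)
                      \<Rightarrow> ((nat \<Rightarrow> real) \<times> nat) list \<Rightarrow> real" where
  "train_margin p d W V S = Min ((\<lambda>(x, y). margin p d W V x y) ` set S)"

definition interpolating :: "nat \<Rightarrow> nat \<Rightarrow> (nat \<Rightarrow> nat \<Rightarrow> real) \<Rightarrow> (nat \<Rightarrow> nat \<Rightarrow> real)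
                      \<Rightarrow> ((nat \<Rightarrow> real) \<times> nat) list \<Rightarrow> bool" where
  "interpolating p d W V S \<longleftrightarrow> train_margin p d W V S > 0"

definition spectral_norm :: "nat \<Rightarrow> nat \<Rightarrow> (nat \<Rightarrow> nat \<Rightarrow> real) \<Rightarrow> real" where
  "spectral_norm p d V =
     Sup {sqrt (\<Sum>k<p. (\<Sum>j<d. V k j * u j)\<^sup>2) | u. (\<Sum>j<d. (u j)\<^sup>2) = 1}"

definition frobenius_norm :: "nat \<Rightarrow> nat \<Rightarrow> (nat \<Rightarrow> nat \<Rightarrow> real) \<Rightarrow> real" where
  "frobenius_norm d p W = sqrt (\<Sum>j<d. \<Sum>r<p. (W j r)\<^sup>2)"

definition test_error :: "nat \<Rightarrow> nat \<Rightarrow> nat \<Rightarrow> (nat \<Rightarrow> nat \<Rightarrow> real) \<Rightarrow> (nat \<Rightarrow> nat \<Rightarrow> real) \<Rightarrow> real" where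
  "test_error p m d W V =
     measure_pmf.prob (data_dist p m) {(x, y). predict p d W V x \<noteq> Some y}"

end

theory Submission
  imports Defs
begin

text \<open>After normalisation the score map is an average of rank-one neurons, so by Maurey's empirical
  method it is \<open>\<gamma>/4\<close>-close, on all admissible inputs, to an average of about
  \<open>m\<^sup>2 p B\<^sup>2\<close> (times logarithms) sampled neurons with weights on a grid, where
  \<open>B = m powr (1.5 m + 2.5) * 6.34 ^ m\<close> and \<open>\<gamma> = c / (sqrt p * B)\<close>. The logarithm of the number of
  such sparse networks is of order \<open>p\<^sup>2 B\<^sup>2\<close>, up to logarithms. A sparse network approximating one
  of normalized margin \<open>\<gamma>\<close> has margin at least \<open>\<gamma>/2\<close> on the sample, so the union bound for the
  realizable case gives test error \<open>p\<^sup>2 B\<^sup>2 / n\<close>, which is at most \<open>p B sqrt (m / n)\<close> unless the latter exceeds 1. In that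
  range \<open>m \<le> ln n\<close>, so powers of \<open>m\<close> count as logarithmic factors.\<close>

section \<open>Samples of independent draws and finite classes in the realizable case\<close>

text \<open>Independence in product form. Working in \<open>ennreal\<close> avoids integrability
  conditions; the cases needed are indicators and exponential moments.\<close>

lemma nn_integral_replicate_pmf_prod_list:
  fixes f :: "'a \<Rightarrow> ennreal"
  shows "(\<integral>\<^sup>+xs. prod_list (map f xs) \<partial>replicate_pmf n q) = (\<integral>\<^sup>+x. f x \<partial>q) ^ n"
  by (induction n) (simp_all add: nn_integral_cmult nn_integral_multc)

lemma prob_replicate_pmf_avoid:
  "measure_pmf.prob (replicate_pmf n q) {xs. set xs \<inter> E = {}} = (1 - measure_pmf.prob q E) ^ n"
proof -
  have ind: "prod_list (map (indicator (- E)) xs) = (indicator {xs. set xs \<inter> E = {}} xs :: ennreal)" for xs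
    by (induction xs) (auto split: split_indicator)
  have "ennreal (measure_pmf.prob (replicate_pmf n q) {xs. set xs \<inter> E = {}}) =
      (\<integral>\<^sup>+xs. prod_list (map (indicator (- E)) xs) \<partial>replicate_pmf n q)"
    unfolding ind by (simp add: measure_pmf.emeasure_eq_measure)
  also have "\<dots> = ennreal (measure_pmf.prob q (- E)) ^ n"
    unfolding nn_integral_replicate_pmf_prod_list by (simp add: measure_pmf.emeasure_eq_measure)
  also have "measure_pmf.prob q (- E) = 1 - measure_pmf.prob q E"
    using measure_pmf.prob_compl[of E q] by (simp add: Compl_eq_Diff_UNIV)
  finally show ?thesis
    by (simp add: ennreal_power)
qed

text \<open>\<open>E i\<close> is the error event of hypothesis \<open>i\<close>. Only hypotheses
  with error above \<open>\<epsilon>\<close> can spoil the event, and each of them survives a sample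
  with probability at most \<open>(1 - \<epsilon>) ^ n\<close>. Requiring zero empirical error is
  what gives rate \<open>1 / n\<close> instead of \<open>1 / sqrt n\<close>.\<close>

lemma realizable_finite_class_bound:
  assumes I: "finite I" and \<delta>: "real (card I) * exp (- \<epsilon> * real n) \<le> \<delta>"
  shows "measure_pmf.prob (replicate_pmf n q)
    {S. \<forall>i\<in>I. set S \<inter> E i = {} \<longrightarrow> measure_pmf.prob q (E i) \<le> \<epsilon>} \<ge> 1 - \<delta>"
proof -
  let ?J = "{i\<in>I. measure_pmf.prob q (E i) > \<epsilon>}"
  let ?G = "{S. \<forall>i\<in>I. set S \<inter> E i = {} \<longrightarrow> measure_pmf.prob q (E i) \<le> \<epsilon>}"
  have each: "measure_pmf.prob (replicate_pmf n q) {S. set S \<inter> E i = {}} \<le> exp (- \<epsilon> * real n)"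
    if "i \<in> ?J" for i
  proof -
    have "(1 - measure_pmf.prob q (E i)) ^ n \<le> (exp (- \<epsilon>)) ^ n"
    proof (rule power_mono)
      have "1 - measure_pmf.prob q (E i) \<le> 1 + (- \<epsilon>)" using that by simp
      also have "\<dots> \<le> exp (- \<epsilon>)" by (rule exp_ge_add_one_self)
      finally show "1 - measure_pmf.prob q (E i) \<le> exp (- \<epsilon>)" .
    qed simp
    then show ?thesis
      by (simp add: prob_replicate_pmf_avoid exp_of_nat2_mult[symmetric])
  qed
  have "measure_pmf.prob (replicate_pmf n q) (- ?G)
      \<le> measure_pmf.prob (replicate_pmf n q) (\<Union>i\<in>?J. {S. set S \<inter> E i = {}})"
    by (rule measure_pmf.finite_measure_mono) auto
  also have "\<dots> \<le> (\<Sum>i\<in>?J. measure_pmf.prob (replicate_pmf n q) {S. set S \<inter> E i = {}})"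
    by (rule measure_pmf.finite_measure_subadditive_finite) (use I in auto)
  also have "\<dots> \<le> real (card ?J) * exp (- \<epsilon> * real n)"
    by (rule sum_bounded_above) (rule each)
  also have "\<dots> \<le> real (card I) * exp (- \<epsilon> * real n)"
    by (intro mult_right_mono) (auto intro!: card_mono I)
  also have "\<dots> \<le> \<delta>" by (rule \<delta>)
  finally show ?thesis
    using measure_pmf.prob_compl[of ?G "replicate_pmf n q"] by (simp add: Compl_eq_Diff_UNIV)
qed

section \<open>A Bernstein tail bound through the second moment\<close>

lemma exp_le_quadratic:
  fixes x :: real
  assumes "\<bar>x\<bar> \<le> 1"
  shows "exp x \<le> 1 + x + x\<^sup>2"
proof (cases "x \<ge> 0")
  case True
  then show ?thesis using exp_bound assms by auto
next
  case False
  obtain y where y: "y = - x" "0 < y" "y \<le> 1" using False assms by auto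
  have "1 + y + y\<^sup>2 / 2 \<le> exp y"
    using exp_lower_Taylor_quadratic[of y] y by simp
  \<comment> \<open>For negative arguments the claim is
    \<open>exp (- y) \<le> 1 - y + y\<^sup>2\<close>; it follows once the candidate times a lower
    bound of \<open>exp y\<close> is at least 1.\<close>
  moreover have "1 \<le> (1 + y + y\<^sup>2 / 2) * (1 - y + y\<^sup>2)"
  proof -
    have "(1 + y + y\<^sup>2 / 2) * (1 - y + y\<^sup>2) = 1 + y\<^sup>2 / 2 + y ^ 3 / 2 + y ^ 4 / 2"
      by (simp add: field_simps power2_eq_square power3_eq_cube power4_eq_xxxx)
    moreover have "0 \<le> y\<^sup>2 / 2 + y ^ 3 / 2 + y ^ 4 / 2" using y(2) by simp
    ultimately show ?thesis by linarith
  qed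
  moreover have "1 - y + y\<^sup>2 \<ge> 0" using y by (simp add: add_increasing2)
  ultimately have "1 \<le> exp y * (1 - y + y\<^sup>2)"
    by (meson mult_right_mono order_trans)
  then have "exp (- y) \<le> 1 - y + y\<^sup>2"
    by (simp add: exp_minus field_simps)
  then show ?thesis using y by simp
qed

text \<open>Chernoff's method, with the exponential replaced by its quadratic bound. The exponent
  involves the second moment \<open>v\<close> and not \<open>b\<^sup>2\<close>; in the sampling of
  neurons \<open>b\<close> is \<open>sqrt p * m\<close> while \<open>v\<close> is
  \<open>2 * m\<^sup>2\<close>, so this saves a factor of order \<open>p\<close>.\<close>

lemma bernstein_upper:
  fixes q :: "'a pmf" and h :: "'a \<Rightarrow> real"
  assumes fin: "finite (set_pmf q)"
    and b: "\<And>j. j \<in> set_pmf q \<Longrightarrow> \<bar>h j\<bar> \<le> b"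
    and v: "measure_pmf.expectation q (\<lambda>j. (h j)\<^sup>2) \<le> v" "0 < v"
    and t: "0 \<le> t" "t * b \<le> v"
  shows "measure_pmf.prob (replicate_pmf M q)
    {js. (\<Sum>j\<leftarrow>js. h j) \<ge> real M * (measure_pmf.expectation q h + t)} \<le> exp (- real M * t\<^sup>2 / (4 * v))"
proof -
  define \<mu> where "\<mu> = measure_pmf.expectation q h"
  \<comment> \<open>The minimizer of \<open>l\<^sup>2 * v - l * t\<close>, with value
    \<open>- t\<^sup>2 / (4 * v)\<close>. The hypothesis \<open>t * b \<le> v\<close> then keeps
    \<open>l * (h j - \<mu>)\<close> in the range where the quadratic bound holds.\<close>
  define l where "l = t / (2 * v)"
  have l0: "l \<ge> 0" using t v by (simp add: l_def)
  have int [simp]: "integrable (measure_pmf q) f" for f :: "'a \<Rightarrow> real"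
    by (rule integrable_measure_pmf_finite[OF fin])
  have \<mu>b: "\<bar>\<mu>\<bar> \<le> b"
  proof -
    have "\<bar>\<mu>\<bar> \<le> measure_pmf.expectation q (\<lambda>j. \<bar>h j\<bar>)" unfolding \<mu>_def by (rule integral_abs_bound)
    also have "\<dots> \<le> measure_pmf.expectation q (\<lambda>j. b)"
      by (rule integral_mono_AE) (auto simp: AE_measure_pmf_iff b)
    finally show ?thesis by simp
  qed
  have mgf: "measure_pmf.expectation q (\<lambda>j. exp (l * (h j - \<mu>))) \<le> exp (l\<^sup>2 * v)"
  proof -
    have "measure_pmf.expectation q (\<lambda>j. exp (l * (h j - \<mu>)))
        \<le> measure_pmf.expectation q (\<lambda>j. 1 + l * (h j - \<mu>) + (l * (h j - \<mu>))\<^sup>2)"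
    proof (rule integral_mono_AE)
      show "AE j in measure_pmf q. exp (l * (h j - \<mu>)) \<le> 1 + l * (h j - \<mu>) + (l * (h j - \<mu>))\<^sup>2"
      proof (subst AE_measure_pmf_iff, intro ballI exp_le_quadratic)
        fix j assume "j \<in> set_pmf q"
        then have "\<bar>h j - \<mu>\<bar> \<le> 2 * b" using b[of j] \<mu>b by linarith
        then have "\<bar>l * (h j - \<mu>)\<bar> \<le> l * (2 * b)"
          using l0 by (simp add: abs_mult mult_left_mono)
        also have "\<dots> \<le> 1" using t v by (simp add: l_def field_simps)
        finally show "\<bar>l * (h j - \<mu>)\<bar> \<le> 1" .
      qed
    qed auto
    also have "\<dots> = measure_pmf.expectation q (\<lambda>j. (1 - l * \<mu> + l\<^sup>2 * \<mu>\<^sup>2) + (l - 2 * l\<^sup>2 * \<mu>) * h j + l\<^sup>2 * (h j)\<^sup>2)"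
      by (rule arg_cong[where f = "measure_pmf.expectation q"])
        (auto simp: fun_eq_iff algebra_simps power2_eq_square)
    also have "\<dots> = (1 - l * \<mu> + l\<^sup>2 * \<mu>\<^sup>2) + (l - 2 * l\<^sup>2 * \<mu>) * \<mu> + l\<^sup>2 * measure_pmf.expectation q (\<lambda>j. (h j)\<^sup>2)"
      by (simp add: \<mu>_def)
    also have "\<dots> = 1 + l\<^sup>2 * measure_pmf.expectation q (\<lambda>j. (h j)\<^sup>2) - l\<^sup>2 * \<mu>\<^sup>2"
      by (simp add: algebra_simps power2_eq_square)
    also have "\<dots> \<le> 1 + l\<^sup>2 * v"
      using mult_left_mono[OF v(1) zero_le_power2[of l]] zero_le_power2[of "l * \<mu>"]
      unfolding power_mult_distrib by linarith
    also have "\<dots> \<le> exp (l\<^sup>2 * v)" by (rule exp_ge_add_one_self)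
    finally show ?thesis .
  qed
  have prod: "prod_list (map (\<lambda>j. ennreal (exp (l * (h j - \<mu>)))) js)
      = ennreal (exp (l * ((\<Sum>j\<leftarrow>js. h j) - real (length js) * \<mu>)))" for js
    by (induction js) (auto simp: ennreal_mult[symmetric] exp_add[symmetric] algebra_simps)
  let ?A = "{js. (\<Sum>j\<leftarrow>js. h j) \<ge> real M * (\<mu> + t)}"
  let ?Q = "measure_pmf (replicate_pmf M q)"
  have "ennreal (measure ?Q ?A) = (\<integral>\<^sup>+js. indicator ?A js \<partial>?Q)"
    by (simp add: measure_pmf.emeasure_eq_measure)
  also have "\<dots> \<le> (\<integral>\<^sup>+js. ennreal (exp (- l * real M * t)) * prod_list (map (\<lambda>j. ennreal (exp (l * (h j - \<mu>)))) js) \<partial>?Q)"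
  proof (rule nn_integral_mono_AE, subst AE_measure_pmf_iff, intro ballI)
    fix js assume "js \<in> set_pmf (replicate_pmf M q)"
    then have len: "length js = M" by (simp add: set_replicate_pmf)
    show "indicator ?A js \<le> ennreal (exp (- l * real M * t)) * prod_list (map (\<lambda>j. ennreal (exp (l * (h j - \<mu>)))) js)"
    proof (cases "js \<in> ?A")
      case True
      then have "l * (real M * (\<mu> + t)) \<le> l * (\<Sum>j\<leftarrow>js. h j)" using l0 by (intro mult_left_mono) auto
      then have "1 \<le> exp (- l * real M * t + l * ((\<Sum>j\<leftarrow>js. h j) - real M * \<mu>))"
        by (simp add: algebra_simps)
      then show ?thesis
        using True unfolding prod len by (simp add: ennreal_mult[symmetric] exp_add[symmetric])
    qed simp
  qed
  also have "\<dots> = ennreal (exp (- l * real M * t)) * (\<integral>\<^sup>+j. ennreal (exp (l * (h j - \<mu>))) \<partial>q) ^ M"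
    by (simp add: nn_integral_cmult nn_integral_replicate_pmf_prod_list)
  also have "(\<integral>\<^sup>+j. ennreal (exp (l * (h j - \<mu>))) \<partial>q) = ennreal (measure_pmf.expectation q (\<lambda>j. exp (l * (h j - \<mu>))))"
    by (rule nn_integral_eq_integral) auto
  also have "ennreal (exp (- l * real M * t)) * ennreal (measure_pmf.expectation q (\<lambda>j. exp (l * (h j - \<mu>)))) ^ M
     \<le> ennreal (exp (- l * real M * t)) * ennreal (exp (l\<^sup>2 * v)) ^ M"
    by (intro mult_left_mono power_mono ennreal_leI mgf) auto
  also have "\<dots> = ennreal (exp (- l * real M * t + real M * (l\<^sup>2 * v)))"
    unfolding exp_add exp_of_nat_mult by (simp add: ennreal_power ennreal_mult[symmetric])
  also have "- l * real M * t + real M * (l\<^sup>2 * v) = - real M * t\<^sup>2 / (4 * v)"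
    using v by (simp add: l_def field_simps power2_eq_square)
  finally show ?thesis by (simp add: \<mu>_def)
qed

lemma bernstein_two_sided:
  fixes q :: "'a pmf" and h :: "'a \<Rightarrow> real"
  assumes fin: "finite (set_pmf q)"
    and b: "\<And>j. j \<in> set_pmf q \<Longrightarrow> \<bar>h j\<bar> \<le> b"
    and v: "measure_pmf.expectation q (\<lambda>j. (h j)\<^sup>2) \<le> v" "0 < v"
    and t: "0 \<le> t" "t * b \<le> v"
  shows "measure_pmf.prob (replicate_pmf M q)
    {js. \<bar>(\<Sum>j\<leftarrow>js. h j) - real M * measure_pmf.expectation q h\<bar> \<ge> real M * t}
      \<le> 2 * exp (- real M * t\<^sup>2 / (4 * v))"
proof -
  let ?U = "\<lambda>h. {js. (\<Sum>j\<leftarrow>js. h j) \<ge> real M * (measure_pmf.expectation q h + t)}"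
  let ?P = "measure_pmf.prob (replicate_pmf M q)"
  have neg: "(\<Sum>j\<leftarrow>js. - h j) = - (\<Sum>j\<leftarrow>js. h j)" for js
    by (induction js) auto
  have "?P {js. \<bar>(\<Sum>j\<leftarrow>js. h j) - real M * measure_pmf.expectation q h\<bar> \<ge> real M * t}
      \<le> ?P (?U h \<union> ?U (\<lambda>j. - h j))"
    by (rule measure_pmf.finite_measure_mono) (auto simp: neg algebra_simps)
  also have "\<dots> \<le> ?P (?U h) + ?P (?U (\<lambda>j. - h j))"
    by (rule measure_Un_le) auto
  also have "?P (?U h) \<le> exp (- real M * t\<^sup>2 / (4 * v))"
    by (rule bernstein_upper[OF assms])
  also have "?P (?U (\<lambda>j. - h j)) \<le> exp (- real M * t\<^sup>2 / (4 * v))"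
    by (rule bernstein_upper[OF fin]) (use b v t in auto)
  finally show ?thesis by simp
qed

section \<open>Row norms and the spectral norm\<close>

text \<open>The supremum is informative only over a bounded set; Cauchy-Schwarz in each row bounds
  it by the Frobenius norm of \<open>V\<close>.\<close>

lemma spectral_norm_ge:
  assumes "(\<Sum>j<d. (u j)\<^sup>2) = 1"
  shows "sqrt (\<Sum>k<p. (\<Sum>j<d. V k j * u j)\<^sup>2) \<le> spectral_norm p d V"
  unfolding spectral_norm_def
proof (rule cSup_upper)
  show "bdd_above {sqrt (\<Sum>k<p. (\<Sum>j<d. V k j * u j)\<^sup>2) |u. (\<Sum>j<d. (u j)\<^sup>2) = 1}"
  proof (rule bdd_aboveI)
    fix y assume "y \<in> {sqrt (\<Sum>k<p. (\<Sum>j<d. V k j * u j)\<^sup>2) |u. (\<Sum>j<d. (u j)\<^sup>2) = 1}"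
    then obtain u where u: "y = sqrt (\<Sum>k<p. (\<Sum>j<d. V k j * u j)\<^sup>2)" "(\<Sum>j<d. (u j)\<^sup>2) = 1"
      by blast
    have "(\<Sum>k<p. (\<Sum>j<d. V k j * u j)\<^sup>2) \<le> (\<Sum>k<p. (\<Sum>j<d. (V k j)\<^sup>2))"
    proof (rule sum_mono)
      fix k
      show "(\<Sum>j<d. V k j * u j)\<^sup>2 \<le> (\<Sum>j<d. (V k j)\<^sup>2)"
        using Cauchy_Schwarz_ineq_sum[of "V k" u "{..<d}"] u(2) by simp
    qed
    then show "y \<le> sqrt (\<Sum>k<p. (\<Sum>j<d. (V k j)\<^sup>2))"
      by (simp add: u(1))
  qed
qed (use assms in blast)

text \<open>A nonzero row, normalised, is a unit vector that \<open>V\<close> maps to a vector whose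
  \<open>k\<close>-th coordinate is the norm of that row. Besides nonnegativity, this is all that
  the proof takes from the spectral norm.\<close>

lemma row_norm_le_spectral_norm:
  assumes "k < p"
  shows "(\<Sum>j<d. (V k j)\<^sup>2) \<le> (spectral_norm p d V)\<^sup>2"
proof -
  define r where "r = sqrt (\<Sum>j<d. (V k j)\<^sup>2)"
  have r2: "r\<^sup>2 = (\<Sum>j<d. (V k j)\<^sup>2)" by (simp add: r_def sum_nonneg)
  have r0: "r \<ge> 0" by (simp add: r_def sum_nonneg)
  show ?thesis
  proof (cases "r = 0")
    case True
    then show ?thesis using r2 by simp
  next
    case False
    have unit: "(\<Sum>j<d. (V k j / r)\<^sup>2) = 1"
      using False by (simp add: power_divide sum_divide_distrib[symmetric] r2[symmetric])
    have row: "(\<Sum>j<d. V k j * (V k j / r)) = r"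
    proof -
      have "(\<Sum>j<d. V k j * (V k j / r)) = r\<^sup>2 / r"
        unfolding r2 by (simp add: sum_divide_distrib power2_eq_square)
      then show ?thesis using False by (simp add: power2_eq_square)
    qed
    have "r\<^sup>2 = (\<Sum>j<d. V k j * (V k j / r))\<^sup>2" by (simp only: row)
    also have "\<dots> \<le> (\<Sum>i<p. (\<Sum>j<d. V i j * (V k j / r))\<^sup>2)"
      by (rule member_le_sum[where f = "\<lambda>i. (\<Sum>j<d. V i j * (V k j / r))\<^sup>2"]) (use assms in auto)
    finally have "r \<le> sqrt (\<Sum>i<p. (\<Sum>j<d. V i j * (V k j / r))\<^sup>2)"
      by (rule real_le_rsqrt)
    also have "\<dots> \<le> spectral_norm p d V" by (rule spectral_norm_ge[OF unit])
    finally show ?thesis using r0 power_mono[of r "spectral_norm p d V" 2] by (simp add: r2)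
  qed
qed

section \<open>ReLU and the network as an expectation over neurons\<close>

lemma relu_mult_nonneg: "0 \<le> c \<Longrightarrow> relu (c * t) = c * relu t"
  by (auto simp: relu_def max_def mult_le_0_iff zero_le_mult_iff)

lemma abs_relu_diff_le: "\<bar>relu s - relu t\<bar> \<le> \<bar>s - t\<bar>"
  by (auto simp: relu_def)

lemma abs_relu_le: "\<bar>relu t\<bar> \<le> \<bar>t\<bar>"
  by (auto simp: relu_def)

text \<open>Importance sampling of the neurons: the part \<open>\<parallel>w\<^sub>j\<parallel>\<^sup>2\<close> of the weight controls the second
  moment, the part \<open>\<parallel>v\<^sub>j\<parallel>\<^sup>2\<close> keeps the sampled coefficients bounded.\<close>

lemma network_as_expectation:
  fixes W V :: "nat \<Rightarrow> nat \<Rightarrow> real"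
  assumes p: "0 < p" and s: "0 < s" and F: "0 < F"
    and rows: "\<And>k. k < p \<Longrightarrow> (\<Sum>j<d. (V k j)\<^sup>2) \<le> s\<^sup>2"
    and W: "(\<Sum>j<d. \<Sum>r<p. (W j r)\<^sup>2) = F\<^sup>2"
  shows "\<exists>(q :: nat pmf) (a :: nat \<Rightarrow> nat \<Rightarrow> real) u. set_pmf q \<subseteq> {..<d} \<and>
    (\<forall>j. \<forall>k<p. \<bar>a j k\<bar> \<le> sqrt (real p)) \<and> (\<forall>j. \<forall>r<p. \<bar>u j r\<bar> \<le> 1) \<and>
    (\<forall>k<p. measure_pmf.expectation q (\<lambda>j. (a j k)\<^sup>2) \<le> 2) \<and>
    (\<forall>k<p. \<forall>x. measure_pmf.expectation q (\<lambda>j. a j k * relu (\<Sum>r<p. u j r * x r))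
      = score p d W V x k / (s * F))"
proof -
  define wn where "wn j = sqrt (\<Sum>r<p. (W j r)\<^sup>2)" for j
  define vn where "vn j = sqrt (\<Sum>k<p. (V k j)\<^sup>2)" for j
  have wn2: "(wn j)\<^sup>2 = (\<Sum>r<p. (W j r)\<^sup>2)" and vn2: "(vn j)\<^sup>2 = (\<Sum>k<p. (V k j)\<^sup>2)" for j
    by (simp_all add: wn_def vn_def sum_nonneg)
  have wn0: "wn j \<ge> 0" and vn0: "vn j \<ge> 0" for j by (simp_all add: wn_def vn_def sum_nonneg)
  \<comment> \<open>The first summand adds up to 1 over all neurons, the second to at most 1, as the
    \<open>p\<close> rows of \<open>V\<close> have squared norm at most \<open>s\<^sup>2\<close>. So
    the normaliser \<open>Z\<close> lies between 1 and 2, and the sampling weight is at least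
    \<open>\<alpha> j / 2\<close>.\<close>
  define \<alpha> where "\<alpha> j = (wn j / F)\<^sup>2 + (vn j / (s * sqrt (real p)))\<^sup>2" for j
  have \<alpha>0: "\<alpha> j \<ge> 0" for j by (simp add: \<alpha>_def)
  define Z where "Z = (\<Sum>j<d. \<alpha> j)"
  have sumw: "(\<Sum>j<d. (wn j / F)\<^sup>2) = 1"
    using F by (simp add: power_divide sum_divide_distrib[symmetric] wn2 W)
  have sumv: "(\<Sum>j<d. (vn j / (s * sqrt (real p)))\<^sup>2) \<le> 1"
  proof -
    have "(\<Sum>j<d. (vn j)\<^sup>2) = (\<Sum>k<p. \<Sum>j<d. (V k j)\<^sup>2)"
      unfolding vn2 by (rule sum.swap)
    also have "\<dots> \<le> (\<Sum>k<p. s\<^sup>2)" by (rule sum_mono) (use rows in auto)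
    finally have "(\<Sum>j<d. (vn j)\<^sup>2) \<le> real p * s\<^sup>2" by simp
    then show ?thesis
      using s p by (simp add: power_divide sum_divide_distrib[symmetric] power_mult_distrib mult.commute)
  qed
  have Z: "1 \<le> Z" "Z \<le> 2"
    using sumw sumv sum_nonneg[of "{..<d}" "\<lambda>j. (vn j / (s * sqrt (real p)))\<^sup>2"]
    by (simp_all add: Z_def \<alpha>_def sum.distrib)
  define w where "w j = (if j < d then \<alpha> j / Z else 0)" for j
  have w0: "0 \<le> w j" for j using Z \<alpha>0 by (simp add: w_def)
  have "(\<integral>\<^sup>+j. ennreal (w j) \<partial>count_space UNIV) = (\<Sum>j<d. ennreal (w j))"
    by (rule nn_integral_count_space'[where A = "{..<d}"]) (auto simp: w_def)
  also have "\<dots> = ennreal (\<Sum>j<d. w j)" by (rule sum_ennreal) (use w0 in auto)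
  also have "(\<Sum>j<d. w j) = 1"
    using Z by (simp add: w_def sum_divide_distrib[symmetric] Z_def[symmetric])
  finally have w1: "(\<integral>\<^sup>+j. ennreal (w j) \<partial>count_space UNIV) = 1" by simp
  define q where "q = embed_pmf w"
  have q: "pmf q j = w j" for j
    unfolding q_def by (rule pmf_embed_pmf[OF w0 w1])
  have setq: "set_pmf q \<subseteq> {..<d}"
    by (auto simp: set_pmf_eq q w_def split: if_splits)
  have expect: "measure_pmf.expectation q f = (\<Sum>j<d. w j * f j)" for f :: "nat \<Rightarrow> real"
    by (subst integral_measure_pmf[of "{..<d}"]) (use setq in \<open>auto simp: q\<close>)
  \<comment> \<open>Dividing by the sampling weight makes the expectation unbiased; the norm
    \<open>wn j\<close> moves from the inner to the outer weight by positive homogeneity. Where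
    \<open>w j = 0\<close> the value is 0.\<close>
  define a where "a j k = V k j * wn j / (s * F * w j)" for j k
  define u where "u j r = W j r / wn j" for j r
  have w_ge: "\<alpha> j / 2 \<le> w j" if "j < d" for j
  proof -
    have "\<alpha> j / 2 \<le> \<alpha> j / Z"
      by (rule divide_left_mono) (use Z \<alpha>0 in auto)
    then show ?thesis by (simp only: w_def that if_True)
  qed
  have Vvn: "\<bar>V k j\<bar> \<le> vn j" if "k < p" for k j
  proof -
    have "(V k j)\<^sup>2 \<le> (\<Sum>k<p. (V k j)\<^sup>2)"
      by (rule member_le_sum[where f = "\<lambda>k. (V k j)\<^sup>2"]) (use that in auto)
    then show ?thesis unfolding vn_def by (intro real_le_rsqrt) simp
  qed
  have Wwn: "\<bar>W j r\<bar> \<le> wn j" if "r < p" for r j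
  proof -
    have "(W j r)\<^sup>2 \<le> (\<Sum>r<p. (W j r)\<^sup>2)"
      by (rule member_le_sum[where f = "\<lambda>r. (W j r)\<^sup>2"]) (use that in auto)
    then show ?thesis unfolding wn_def by (intro real_le_rsqrt) simp
  qed
  show ?thesis
  proof (rule exI[of _ q], rule exI[of _ a], rule exI[of _ u], intro conjI allI impI)
    show "set_pmf q \<subseteq> {..<d}" by (rule setq)
  next
    fix j k :: nat assume k: "k < p"
    show "\<bar>a j k\<bar> \<le> sqrt (real p)"
    proof (cases "w j = 0")
      case False
      then have j: "j < d" and wj: "w j > 0" using w0[of j] by (auto simp: w_def split: if_splits)
      \<comment> \<open>The arithmetic-geometric inequality uses both parts of the weight at once;
        it yields the bound \<open>sqrt p\<close> on the coefficients.\<close>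
      have "2 * ((wn j / F) * (vn j / (s * sqrt (real p)))) \<le> \<alpha> j"
        unfolding \<alpha>_def using sum_squares_bound[of "wn j / F" "vn j / (s * sqrt (real p))"] by (simp add: mult.assoc)
      then have "(wn j / F) * (vn j / (s * sqrt (real p))) \<le> w j" using w_ge[OF j] by linarith
      then have "vn j * wn j \<le> sqrt (real p) * (s * F * w j)"
        using s F p by (simp add: field_simps)
      moreover have "\<bar>V k j\<bar> * wn j \<le> vn j * wn j" by (intro mult_right_mono Vvn k wn0)
      ultimately have "\<bar>V k j\<bar> * wn j \<le> sqrt (real p) * (s * F * w j)" by linarith
      then show ?thesis using s F wj wn0[of j] by (simp add: a_def abs_mult pos_divide_le_eq)
    qed (simp add: a_def)
  next
    fix j r :: nat assume "r < p"
    then show "\<bar>u j r\<bar> \<le> 1"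
      using Wwn[of r j] wn0[of j] by (cases "wn j = 0") (simp_all add: u_def)
  next
    fix k assume k: "k < p"
    have "w j * (a j k)\<^sup>2 \<le> 2 * (V k j)\<^sup>2 / s\<^sup>2" if j: "j < d" for j
    proof (cases "w j = 0")
      case False
      then have wj: "w j > 0" using w0[of j] by auto
      \<comment> \<open>For the second moment the input part alone suffices: it cancels
        \<open>wn j\<close> and leaves the squared norm of row \<open>k\<close> of
        \<open>V\<close>.\<close>
      have "(wn j / F)\<^sup>2 \<le> \<alpha> j" by (simp add: \<alpha>_def)
      then have *: "(wn j / F)\<^sup>2 \<le> 2 * w j" using w_ge[OF j] by linarith
      have "w j * (a j k)\<^sup>2 = (V k j)\<^sup>2 / s\<^sup>2 * ((wn j / F)\<^sup>2 / w j)"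
        using s F wj by (simp add: a_def field_simps power2_eq_square)
      also have "\<dots> \<le> (V k j)\<^sup>2 / s\<^sup>2 * 2"
        using * wj by (intro mult_left_mono) (simp_all add: pos_divide_le_eq)
      finally show ?thesis by (simp add: mult.commute)
    qed simp
    then have "(\<Sum>j<d. w j * (a j k)\<^sup>2) \<le> (\<Sum>j<d. 2 * (V k j)\<^sup>2 / s\<^sup>2)"
      by (intro sum_mono) auto
    also have "\<dots> = 2 * (\<Sum>j<d. (V k j)\<^sup>2) / s\<^sup>2"
      by (simp add: sum_divide_distrib sum_distrib_left)
    also have "\<dots> \<le> 2" using rows[OF k] s by (simp add: field_simps)
    finally show "measure_pmf.expectation q (\<lambda>j. (a j k)\<^sup>2) \<le> 2" by (simp add: expect)
  next
    fix k :: nat and x :: "nat \<Rightarrow> real"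
    have "w j * (a j k * relu (\<Sum>r<p. u j r * x r)) = V k j * relu (\<Sum>r<p. W j r * x r) / (s * F)"
      if j: "j < d" for j
    proof (cases "wn j = 0")
      \<comment> \<open>A neuron with zero input weights contributes 0 on both sides, so the
        division by zero in \<open>u\<close> is harmless.\<close>
      case True
      then have "W j r = 0" if "r < p" for r using Wwn[OF that, of j] by simp
      then show ?thesis using True by (simp add: a_def relu_def)
    next
      case False
      then have "\<alpha> j \<noteq> 0"
        using F unfolding \<alpha>_def by (simp add: add_nonneg_eq_0_iff)
      then have wj: "w j \<noteq> 0" using j Z by (simp add: w_def)
      have "relu (\<Sum>r<p. W j r * x r) = relu (wn j * (\<Sum>r<p. u j r * x r))"
        using False by (simp add: u_def sum_distrib_left)
      then show ?thesis
        using wj by (simp add: relu_mult_nonneg[OF wn0] a_def)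
    qed
    then show "measure_pmf.expectation q (\<lambda>j. a j k * relu (\<Sum>r<p. u j r * x r))
        = score p d W V x k / (s * F)"
      by (simp add: expect score_def sum_divide_distrib)
  qed
qed

section \<open>Existence of a good sample, and rounding to a grid\<close>

text \<open>The probabilistic method: by the union bound the bad samples have probability below 1,
  so they do not exhaust the support.\<close>

lemma uniform_empirical_mean:
  fixes q :: "'a pmf" and h :: "'i \<Rightarrow> 'a \<Rightarrow> real"
  assumes fin: "finite (set_pmf q)" and I: "finite I"
    and b: "\<And>i j. i \<in> I \<Longrightarrow> j \<in> set_pmf q \<Longrightarrow> \<bar>h i j\<bar> \<le> b"
    and v: "\<And>i. i \<in> I \<Longrightarrow> measure_pmf.expectation q (\<lambda>j. (h i j)\<^sup>2) \<le> v" "0 < v"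
    and t: "0 \<le> t" "t * b \<le> v"
    and M: "real (card I) * (2 * exp (- real M * t\<^sup>2 / (4 * v))) < 1"
  obtains js where "length js = M" "set js \<subseteq> set_pmf q"
    "\<And>i. i \<in> I \<Longrightarrow> \<bar>(\<Sum>j\<leftarrow>js. h i j) - real M * measure_pmf.expectation q (h i)\<bar> < real M * t"
proof -
  let ?Q = "replicate_pmf M q"
  let ?B = "\<lambda>i. {js. \<bar>(\<Sum>j\<leftarrow>js. h i j) - real M * measure_pmf.expectation q (h i)\<bar> \<ge> real M * t}"
  have "measure_pmf.prob ?Q (\<Union>i\<in>I. ?B i) \<le> (\<Sum>i\<in>I. measure_pmf.prob ?Q (?B i))"
    by (rule measure_pmf.finite_measure_subadditive_finite) (use I in auto)
  also have "\<dots> \<le> real (card I) * (2 * exp (- real M * t\<^sup>2 / (4 * v)))"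
    by (rule sum_bounded_above) (rule bernstein_two_sided[OF fin b v t])
  also have "\<dots> < 1" by (rule M)
  finally have "\<not> set_pmf ?Q \<subseteq> (\<Union>i\<in>I. ?B i)"
    using measure_pmf.prob_eq_1[of "\<Union>i\<in>I. ?B i" ?Q] by (auto simp: AE_measure_pmf_iff)
  then obtain js where js: "js \<in> set_pmf ?Q" "js \<notin> (\<Union>i\<in>I. ?B i)" by blast
  show thesis
  proof (rule that)
    show "length js = M" "set js \<subseteq> set_pmf q"
      using js(1) by (auto simp: set_replicate_pmf)
  qed (use js(2) in \<open>auto simp: not_le\<close>)
qed

lemma abs_diff_floor_le:
  assumes "0 < (K::nat)"
  shows "\<bar>a - real_of_int \<lfloor>a * real K\<rfloor> / real K\<bar> \<le> 1 / real K"
proof -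
  have "\<bar>a * real K - real_of_int \<lfloor>a * real K\<rfloor>\<bar> \<le> 1"
    by linarith
  then have "\<bar>(a * real K - real_of_int \<lfloor>a * real K\<rfloor>) / real K\<bar> \<le> 1 / real K"
    using assms by (simp add: divide_right_mono)
  then show ?thesis using assms by (simp add: diff_divide_distrib)
qed

text \<open>The error splits into \<open>a * (relu z - relu z')\<close> and
  \<open>(a - a') * relu z'\<close>. ReLU is 1-Lipschitz, so the first costs
  \<open>A * m / K\<close>; rounding at most doubles the bound \<open>m\<close> on the
  preactivation, so the second costs \<open>2 * m / K\<close>.\<close>

lemma round_neuron:
  fixes a A m :: real and u x :: "nat \<Rightarrow> real" and K :: nat
  assumes K: "0 < K" and a: "\<bar>a\<bar> \<le> A"
    and u: "\<And>r. r < p \<Longrightarrow> \<bar>u r\<bar> \<le> 1"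
    and x: "\<And>r. r < p \<Longrightarrow> 0 \<le> x r" "(\<Sum>r<p. x r) \<le> m"
  shows "\<bar>a * relu (\<Sum>r<p. u r * x r)
      - real_of_int \<lfloor>a * real K\<rfloor> / real K * relu (\<Sum>r<p. real_of_int \<lfloor>u r * real K\<rfloor> / real K * x r)\<bar>
    \<le> (A + 2) * m / real K"
proof -
  define a' where "a' = real_of_int \<lfloor>a * real K\<rfloor> / real K"
  define u' where "u' r = real_of_int \<lfloor>u r * real K\<rfloor> / real K" for r
  define z where "z = (\<Sum>r<p. u r * x r)"
  define z' where "z' = (\<Sum>r<p. u' r * x r)"
  have m0: "0 \<le> m" using x sum_nonneg[of "{..<p}" x] by force
  have A0: "0 \<le> A" using a by linarith
  have K1: "1 / real K \<le> 1" using K by simp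
  have da: "\<bar>a - a'\<bar> \<le> 1 / real K" unfolding a'_def by (rule abs_diff_floor_le[OF K])
  have du: "\<bar>u r - u' r\<bar> \<le> 1 / real K" for r unfolding u'_def by (rule abs_diff_floor_le[OF K])
  have weighted: "\<bar>\<Sum>r<p. b r * x r\<bar> \<le> e * m" if b: "\<And>r. r < p \<Longrightarrow> \<bar>b r\<bar> \<le> e" "0 \<le> e" for b e
  proof -
    have "\<bar>\<Sum>r<p. b r * x r\<bar> \<le> (\<Sum>r<p. \<bar>b r * x r\<bar>)" by (rule sum_abs)
    also have "\<dots> \<le> (\<Sum>r<p. e * x r)"
      by (rule sum_mono) (use b x in \<open>auto simp: abs_mult intro!: mult_right_mono\<close>)
    also have "\<dots> \<le> e * m" using b x by (simp add: sum_distrib_left[symmetric] mult_left_mono)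
    finally show ?thesis .
  qed
  have dz: "\<bar>z - z'\<bar> \<le> 1 / real K * m"
    using weighted[of "\<lambda>r. u r - u' r" "1 / real K"] du
    by (simp add: z_def z'_def left_diff_distrib sum_subtractf)
  have z: "\<bar>z\<bar> \<le> m" using weighted[of u 1] u by (simp add: z_def)
  have z': "\<bar>z'\<bar> \<le> 2 * m" using z dz mult_right_mono[OF K1 m0] by linarith
  have "\<bar>a * relu z - a' * relu z'\<bar> = \<bar>a * (relu z - relu z') + (a - a') * relu z'\<bar>"
    by (simp add: algebra_simps)
  also have "\<dots> \<le> \<bar>a\<bar> * \<bar>relu z - relu z'\<bar> + \<bar>a - a'\<bar> * \<bar>relu z'\<bar>"
    unfolding abs_mult[symmetric] by (rule abs_triangle_ineq)
  also have "\<dots> \<le> A * (1 / real K * m) + 1 / real K * (2 * m)"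
    using abs_relu_diff_le[of z z'] abs_relu_le[of z'] dz z' da a A0 K
    by (intro add_mono mult_mono) auto
  also have "\<dots> = (A + 2) * m / real K" by (simp add: algebra_simps add_divide_distrib)
  finally show ?thesis unfolding a'_def u'_def z_def z'_def .
qed

section \<open>The finite class of sparse networks with grid weights\<close>

text \<open>Integer entries stand for multiples of \<open>1 / K\<close>. With
  \<open>R = p * K\<close> the grid spans the interval from \<open>-p\<close> to \<open>p\<close>,
  which contains the outer coefficients, bounded by \<open>sqrt p\<close>, and the inner weights,
  bounded by 1.\<close>

definition grid_lists :: "nat \<Rightarrow> nat \<Rightarrow> int list set" where
  "grid_lists p R = {l. set l \<subseteq> {- int R..int R} \<and> length l = p}"

text \<open>One pair per sampled neuron: first its output coefficients, then its input
  weights.\<close>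

definition network_codes :: "nat \<Rightarrow> nat \<Rightarrow> nat \<Rightarrow> (int list \<times> int list) list set" where
  "network_codes p R M = {c. set c \<subseteq> grid_lists p R \<times> grid_lists p R \<and> length c = M}"

definition code_score :: "nat \<Rightarrow> nat \<Rightarrow> (int list \<times> int list) list \<Rightarrow> (nat \<Rightarrow> real) \<Rightarrow> nat \<Rightarrow> real" where
  "code_score p K c x k = (\<Sum>(\<alpha>, \<beta>)\<leftarrow>c. real_of_int (\<alpha> ! k) / real K *
     relu (\<Sum>r<p. real_of_int (\<beta> ! r) / real K * x r)) / real (length c)"

lemma finite_grid_lists: "finite (grid_lists p R)"
  unfolding grid_lists_def by (simp add: finite_lists_length_eq)

lemma card_grid_lists: "card (grid_lists p R) = (2 * R + 1) ^ p"
proof -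
  have "card {- int R..int R} = 2 * R + 1" by simp
  then show ?thesis unfolding grid_lists_def by (simp only: card_lists_length_eq finite_atLeastAtMost_int)
qed

lemma finite_network_codes: "finite (network_codes p R M)"
  unfolding network_codes_def by (intro finite_lists_length_eq finite_cartesian_product finite_grid_lists)

lemma card_network_codes: "card (network_codes p R M) = (2 * R + 1) ^ (2 * p * M)"
  unfolding network_codes_def power_mult[of _ "2 * p" M]
  unfolding mult_2[of p] power_add
  by (simp add: card_lists_length_eq finite_grid_lists card_grid_lists card_cartesian_product)

lemma round_in_grid:
  assumes "\<bar>a\<bar> \<le> real p" "1 \<le> K"
  shows "\<lfloor>a * real K\<rfloor> \<in> {- int (p * K)..int (p * K)}"
proof -
  have "\<bar>a * real K\<bar> \<le> real p * real K"
    using assms by (simp add: abs_mult mult_right_mono)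
  then have "- real (p * K) \<le> a * real K" "a * real K \<le> real (p * K)"
    by (simp_all add: abs_le_iff)
  then show ?thesis by (simp add: le_floor_iff floor_le_iff)
qed

text \<open>Maurey's empirical method, followed by rounding. A union bound over all admissible inputs is
  affordable because there are only \<open>p ^ m\<close> of them.\<close>

lemma network_code_approximation:
  fixes W V :: "nat \<Rightarrow> nat \<Rightarrow> real" and m t s F :: real and X :: "(nat \<Rightarrow> real) set"
  assumes p: "0 < p" and s: "0 < s" and F: "0 < F"
    and rows: "\<And>k. k < p \<Longrightarrow> (\<Sum>j<d. (V k j)\<^sup>2) \<le> s\<^sup>2"
    and W: "(\<Sum>j<d. \<Sum>r<p. (W j r)\<^sup>2) = F\<^sup>2"
    and X: "finite X" "\<And>x r. x \<in> X \<Longrightarrow> r < p \<Longrightarrow> 0 \<le> x r" "\<And>x. x \<in> X \<Longrightarrow> (\<Sum>r<p. x r) \<le> m"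
    and m: "0 < m" and t: "0 < t" "t * (sqrt (real p) * m) \<le> 2 * m\<^sup>2"
    and K: "1 \<le> K" and M: "0 < M"
    and card: "real (card X * p) * (2 * exp (- real M * t\<^sup>2 / (4 * (2 * m\<^sup>2)))) < 1"
  obtains c where "c \<in> network_codes p (p * K) M"
    "\<And>x k. x \<in> X \<Longrightarrow> k < p \<Longrightarrow>
      \<bar>code_score p K c x k - score p d W V x k / (s * F)\<bar> < t + (sqrt (real p) + 2) * m / real K"
proof -
  obtain q :: "nat pmf" and a u :: "nat \<Rightarrow> nat \<Rightarrow> real" where q: "set_pmf q \<subseteq> {..<d}"
    and a: "\<And>j k. k < p \<Longrightarrow> \<bar>a j k\<bar> \<le> sqrt (real p)"
    and u: "\<And>j r. r < p \<Longrightarrow> \<bar>u j r\<bar> \<le> 1"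
    and a2: "\<And>k. k < p \<Longrightarrow> measure_pmf.expectation q (\<lambda>j. (a j k)\<^sup>2) \<le> 2"
    and mean: "\<And>k x. k < p \<Longrightarrow> measure_pmf.expectation q (\<lambda>j. a j k * relu (\<Sum>r<p. u j r * x r))
            = score p d W V x k / (s * F)"
    using network_as_expectation[where V = V, OF p s F rows W] by blast
  define h where "h = (\<lambda>(x, k) j. a j k * relu (\<Sum>r<p. u j r * x r))"
  have fin: "finite (set_pmf q)" using q finite_subset by blast
  have int: "integrable (measure_pmf q) f" for f :: "nat \<Rightarrow> real"
    by (rule integrable_measure_pmf_finite[OF fin])
  have relu_m: "\<bar>relu (\<Sum>r<p. u j r * x r)\<bar> \<le> m" if "x \<in> X" for x j
  proof -
    have "\<bar>\<Sum>r<p. u j r * x r\<bar> \<le> (\<Sum>r<p. \<bar>u j r * x r\<bar>)" by (rule sum_abs)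
    also have "\<dots> \<le> (\<Sum>r<p. x r)"
      using u X(2)[OF that] by (intro sum_mono) (auto simp: abs_mult intro!: mult_left_le_one_le)
    finally show ?thesis using abs_relu_le[of "\<Sum>r<p. u j r * x r"] X(3)[OF that] by linarith
  qed
  obtain js where len: "length js = M" and js: "set js \<subseteq> set_pmf q"
    and emp: "\<And>i. i \<in> X \<times> {..<p} \<Longrightarrow>
      \<bar>(\<Sum>j\<leftarrow>js. h i j) - real M * measure_pmf.expectation q (h i)\<bar> < real M * t"
  \<comment> \<open>Every preactivation is at most \<open>m\<close> in absolute value, so range and
    second moment of \<open>h\<close> are those of the coefficients, scaled by \<open>m\<close> and
    \<open>m\<^sup>2\<close>.\<close>
  proof (rule uniform_empirical_mean[of q "X \<times> {..<p}" h "sqrt (real p) * m" "2 * m\<^sup>2" t M])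
    fix i j assume i: "i \<in> X \<times> {..<p}"
    then obtain x k where [simp]: "i = (x, k)" and xk: "x \<in> X" "k < p" by auto
    show "\<bar>h i j\<bar> \<le> sqrt (real p) * m"
      unfolding h_def by (simp add: abs_mult) (intro mult_mono a relu_m xk; simp)
  next
    fix i assume i: "i \<in> X \<times> {..<p}"
    then obtain x k where [simp]: "i = (x, k)" and xk: "x \<in> X" "k < p" by auto
    have "measure_pmf.expectation q (\<lambda>j. (h i j)\<^sup>2) \<le> measure_pmf.expectation q (\<lambda>j. (a j k)\<^sup>2 * m\<^sup>2)"
    proof (rule integral_mono[OF int int])
      fix j
      have "(relu (\<Sum>r<p. u j r * x r))\<^sup>2 \<le> m\<^sup>2"
        using relu_m[OF xk(1), of j] m by (simp add: abs_le_square_iff[symmetric])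
      then show "(h i j)\<^sup>2 \<le> (a j k)\<^sup>2 * m\<^sup>2"
        by (simp add: h_def power_mult_distrib mult_left_mono)
    qed
    also have "\<dots> = measure_pmf.expectation q (\<lambda>j. (a j k)\<^sup>2) * m\<^sup>2" by simp
    also have "\<dots> \<le> 2 * m\<^sup>2" using a2[OF xk(2)] by (intro mult_right_mono) auto
    finally show "measure_pmf.expectation q (\<lambda>j. (h i j)\<^sup>2) \<le> 2 * m\<^sup>2" .
  qed (use fin X m t card in \<open>auto simp: card_cartesian_product\<close>)
  define code where
    "code j = (map (\<lambda>k. \<lfloor>a j k * real K\<rfloor>) [0..<p], map (\<lambda>r. \<lfloor>u j r * real K\<rfloor>) [0..<p])" for j
  define c where "c = map code js"
  have sqrtp: "sqrt (real p) \<le> real p"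
    using p by (intro real_le_lsqrt) (auto simp: power2_eq_square)
  have code: "code j \<in> grid_lists p (p * K) \<times> grid_lists p (p * K)" for j
  proof -
    have "\<lfloor>a j k * real K\<rfloor> \<in> {- int (p * K)..int (p * K)}" if "k < p" for k
      using a[OF that, of j] sqrtp by (intro round_in_grid K) linarith
    moreover have "\<lfloor>u j r * real K\<rfloor> \<in> {- int (p * K)..int (p * K)}" if "r < p" for r
      using u[OF that, of j] p by (intro round_in_grid K) linarith
    ultimately show ?thesis unfolding code_def grid_lists_def by auto
  qed
  show thesis
  proof (rule that)
    have "set c \<subseteq> grid_lists p (p * K) \<times> grid_lists p (p * K)"
      unfolding c_def set_map using code by (rule image_subsetI)
    then show "c \<in> network_codes p (p * K) M"
      by (simp add: network_codes_def c_def len)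
  next
    fix x k assume x: "x \<in> X" and k: "k < p"
    define h' where "h' j = real_of_int \<lfloor>a j k * real K\<rfloor> / real K *
      relu (\<Sum>r<p. real_of_int \<lfloor>u j r * real K\<rfloor> / real K * x r)" for j
    have score': "code_score p K c x k = (\<Sum>j\<leftarrow>js. h' j) / real M"
      using k by (simp add: code_score_def c_def code_def len h'_def o_def)
    define e where "e = (sqrt (real p) + 2) * m / real K"
    have each: "\<bar>h (x, k) j - h' j\<bar> \<le> e" for j
      unfolding h_def h'_def e_def prod.case
      by (rule round_neuron) (use K a[OF k] u X x in auto)
    have "\<bar>(\<Sum>j\<leftarrow>l. h (x, k) j) - (\<Sum>j\<leftarrow>l. h' j)\<bar> \<le> real (length l) * e" for l
    proof (induction l)
      case (Cons j l)
      then show ?case using each[of j] by (simp add: algebra_simps)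
    qed simp
    from this[of js] have 1: "\<bar>(\<Sum>j\<leftarrow>js. h (x, k) j) - (\<Sum>j\<leftarrow>js. h' j)\<bar> \<le> real M * e" by (simp add: len)
    have "measure_pmf.expectation q (h (x, k)) = score p d W V x k / (s * F)"
      using mean[OF k] by (simp add: h_def)
    with emp[of "(x, k)"] x k have
      2: "\<bar>(\<Sum>j\<leftarrow>js. h (x, k) j) - real M * (score p d W V x k / (s * F))\<bar> < real M * t" by simp
    have "\<bar>(\<Sum>j\<leftarrow>js. h' j) - real M * (score p d W V x k / (s * F))\<bar> < real M * (t + e)"
      using 1 2 by (simp add: algebra_simps)
    then have "\<bar>real M * (code_score p K c x k - score p d W V x k / (s * F))\<bar> < real M * (t + e)"
      using M by (simp add: score' right_diff_distrib)
    then show "\<bar>code_score p K c x k - score p d W V x k / (s * F)\<bar> < t + (sqrt (real p) + 2) * m / real K"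
      using M by (simp add: abs_mult e_def)
  qed
qed

section \<open>Admissible inputs, margins and prediction errors\<close>

text \<open>Taking count vectors of words, as \<open>data_dist\<close> does, makes the cardinality
  bound \<open>p ^ m\<close> immediate.\<close>

definition admissible_inputs :: "nat \<Rightarrow> nat \<Rightarrow> (nat \<Rightarrow> real) set" where
  "admissible_inputs p m = (\<lambda>l r. real (count_list l r)) ` {l. set l \<subseteq> {..<p} \<and> length l = m}"

lemma finite_admissible_inputs: "finite (admissible_inputs p m)"
  by (simp add: admissible_inputs_def finite_lists_length_eq)

lemma card_admissible_inputs: "card (admissible_inputs p m) \<le> p ^ m"
  unfolding admissible_inputs_def
  using card_image_le[OF finite_lists_length_eq[of "{..<p}" m], of "\<lambda>l r. real (count_list l r)"]
  by (simp add: card_lists_length_eq)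

lemma admissible_inputs_nonneg: "x \<in> admissible_inputs p m \<Longrightarrow> 0 \<le> x r"
  by (auto simp: admissible_inputs_def)

lemma admissible_inputs_sum: "x \<in> admissible_inputs p m \<Longrightarrow> (\<Sum>r<p. x r) = real m"
  by (auto simp: admissible_inputs_def of_nat_sum[symmetric] sum_count_set simp del: of_nat_sum)

lemma set_data_dist:
  assumes "0 < p" "(x, y) \<in> set_pmf (data_dist p m)"
  shows "x \<in> admissible_inputs p m" "y < p"
proof -
  have "set_pmf (pmf_of_set {..<p}) = {..<p}"
    by (rule set_pmf_of_set) (use assms in auto)
  then show "x \<in> admissible_inputs p m" "y < p"
    using assms by (auto simp: data_dist_def set_replicate_pmf admissible_inputs_def)
qed

lemma margin_le:
  assumes "k < p" "k \<noteq> y"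
  shows "margin p d W V x y \<le> score p d W V x y - score p d W V x k"
proof -
  have "score p d W V x k \<le> Max {score p d W V x k | k. k < p \<and> k \<noteq> y}"
    by (rule Max_ge) (use assms in auto)
  then show ?thesis by (simp add: margin_def)
qed

lemma train_margin_le:
  assumes "(x, y) \<in> set S"
  shows "train_margin p d W V S \<le> margin p d W V x y"
  unfolding train_margin_def by (rule Min_le) (use assms in force)+

text \<open>A tie for the top score makes the prediction \<open>None\<close>, which counts as an
  error; hence the competitor need only reach the score of \<open>y\<close>.\<close>

lemma predict_wrong:
  assumes "y < p" "predict p d W V x \<noteq> Some y"
  obtains k where "k < p" "k \<noteq> y" "score p d W V x y \<le> score p d W V x k"
proof (rule ccontr)
  assume "\<not> thesis"
  then have y: "\<forall>k<p. k \<noteq> y \<longrightarrow> score p d W V x y > score p d W V x k"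
    using that by force
  have "(THE l. l < p \<and> (\<forall>k<p. k \<noteq> l \<longrightarrow> score p d W V x l > score p d W V x k)) = y"
  proof (rule the_equality)
    fix l assume l: "l < p \<and> (\<forall>k<p. k \<noteq> l \<longrightarrow> score p d W V x l > score p d W V x k)"
    show "l = y" using l y assms(1) less_asym by blast
  qed (use assms y in auto)
  then have "predict p d W V x = Some y"
    using y assms(1) unfolding predict_def by auto
  with assms(2) show False by simp
qed

section \<open>From normalized margin to test error\<close>

text \<open>A code whose scores are within \<open>\<gamma> / 4\<close> of the normalized scores
  shifts margins by less than \<open>\<gamma> / 2\<close>. So margin \<open>\<gamma>\<close> on the
  sample forces code margin above \<open>\<gamma> / 2\<close> there, while a misclassified point has
  code margin below \<open>\<gamma> / 2\<close>. The finite-class bound for the codes thus covers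
  all weights at once.\<close>

lemma margin_generalization:
  fixes \<gamma> \<epsilon> \<delta> :: real
  assumes p: "2 \<le> p" and m: "0 < m" and n: "0 < n" and K: "1 \<le> K" and M: "0 < M"
    and \<gamma>: "0 < \<gamma>" "\<gamma> * sqrt (real p) \<le> 1"
    and K\<gamma>: "8 * (sqrt (real p) + 2) * real m \<le> \<gamma> * real K"
    and M\<gamma>: "real (p ^ m * p) * (2 * exp (- real M * \<gamma>\<^sup>2 / (512 * (real m)\<^sup>2))) < 1"
    and \<epsilon>: "real ((2 * (p * K) + 1) ^ (2 * p * M)) * exp (- \<epsilon> * real n) \<le> \<delta>"
  shows "measure_pmf.prob (train_dist p m n)
     {S. \<forall>W V. \<gamma> \<le> train_margin p d W V S / (spectral_norm p d V * frobenius_norm d p W)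
        \<longrightarrow> test_error p m d W V \<le> \<epsilon>} \<ge> 1 - \<delta>"
proof -
  let ?D = "data_dist p m"
  define G where "G = network_codes p (p * K) M"
  define E where "E c = {(x, y). \<exists>k<p. k \<noteq> y \<and> code_score p K c x y - code_score p K c x k < \<gamma> / 2}" for c
  have p0: "0 < p" using p by simp
  let ?good = "{S. \<forall>c\<in>G. set S \<inter> E c = {} \<longrightarrow> measure_pmf.prob ?D (E c) \<le> \<epsilon>}"
  let ?goal = "{S. \<forall>W V. \<gamma> \<le> train_margin p d W V S / (spectral_norm p d V * frobenius_norm d p W)
        \<longrightarrow> test_error p m d W V \<le> \<epsilon>}"
  have "1 - \<delta> \<le> measure_pmf.prob (train_dist p m n) ?good"
    unfolding train_dist_def
    by (rule realizable_finite_class_bound)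
      (use \<epsilon> in \<open>simp_all add: G_def finite_network_codes card_network_codes\<close>)
  also have "\<dots> \<le> measure_pmf.prob (train_dist p m n) ?goal"
  proof (rule measure_pmf.finite_measure_mono_AE)
    \<comment> \<open>Only samples in the support are compared, because the approximation is
      available at admissible inputs only.\<close>
    show "AE S in measure_pmf (train_dist p m n). S \<in> ?good \<longrightarrow> S \<in> ?goal"
    proof (subst AE_measure_pmf_iff, safe)
      fix S W V
      assume S: "S \<in> set_pmf (train_dist p m n)"
        and good: "\<forall>c\<in>G. set S \<inter> E c = {} \<longrightarrow> measure_pmf.prob ?D (E c) \<le> \<epsilon>"
        and ratio: "\<gamma> \<le> train_margin p d W V S / (spectral_norm p d V * frobenius_norm d p W)"
      define s where "s = spectral_norm p d V"
      define F where "F = frobenius_norm d p W"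
      \<comment> \<open>Division by zero gives 0, which is below \<open>\<gamma>\<close>, so
        degenerate weights fail the margin condition.\<close>
      have "s * F \<noteq> 0" using ratio \<gamma> by (auto simp: s_def F_def)
      then have "s \<noteq> 0" "F \<noteq> 0" by auto
      have "F \<ge> 0" by (simp add: F_def frobenius_norm_def sum_nonneg)
      with \<open>F \<noteq> 0\<close> have F: "0 < F" by simp
      have F2: "(\<Sum>j<d. \<Sum>r<p. (W j r)\<^sup>2) = F\<^sup>2"
        by (simp add: F_def frobenius_norm_def sum_nonneg)
      \<comment> \<open>With \<open>d\<close> nonzero a unit vector exists, and testing the supremum
        at it shows \<open>s\<close> to be nonnegative.\<close>
      have "d \<noteq> 0" using \<open>F \<noteq> 0\<close> by (cases "d = 0") (simp_all add: F_def frobenius_norm_def)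
      then have "(\<Sum>j<d. (if j = 0 then 1 else 0 :: real)\<^sup>2) = 1"
        by (simp add: if_distrib[of "\<lambda>z. z\<^sup>2"] cong: if_cong)
      from spectral_norm_ge[where p = p and V = V, OF this] have "0 \<le> s"
        unfolding s_def by (rule order_trans[rotated]) (simp add: sum_nonneg)
      with \<open>s \<noteq> 0\<close> have s: "0 < s" by simp
      have rows: "(\<Sum>j<d. (V k j)\<^sup>2) \<le> s\<^sup>2" if "k < p" for k
        unfolding s_def by (rule row_norm_le_spectral_norm[OF that])
      obtain c where c: "c \<in> network_codes p (p * K) M"
        and approx: "\<And>x k. x \<in> admissible_inputs p m \<Longrightarrow> k < p \<Longrightarrow>
          \<bar>code_score p K c x k - score p d W V x k / (s * F)\<bar>
            < \<gamma> / 8 + (sqrt (real p) + 2) * real m / real K"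
      \<comment> \<open>The tolerance \<open>\<gamma> / 4\<close> is split evenly between sampling,
        \<open>t = \<gamma> / 8\<close>, and rounding; \<open>512\<close> is
        \<open>4 * 2 * 8\<^sup>2\<close>.\<close>
      proof (rule network_code_approximation[where V = V, OF p0 s F rows F2 finite_admissible_inputs[of p m] _ _ _ _ _ K M])
        show "\<gamma> / 8 * (sqrt (real p) * real m) \<le> 2 * (real m)\<^sup>2"
        proof -
          have "\<gamma> / 8 * (sqrt (real p) * real m) = (\<gamma> * sqrt (real p)) * (real m / 8)" by simp
          also have "\<dots> \<le> 1 * (real m / 8)" by (rule mult_right_mono) (use \<gamma> in auto)
          also have "\<dots> \<le> real m * 1" by simp
          also have "\<dots> \<le> real m * (2 * real m)" using m by (intro mult_left_mono) auto
          finally show ?thesis by (simp add: power2_eq_square)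
        qed
        have "real (card (admissible_inputs p m) * p) \<le> real (p ^ m * p)"
          unfolding of_nat_le_iff by (intro mult_right_mono card_admissible_inputs) auto
        then have "real (card (admissible_inputs p m) * p) * (2 * exp (- real M * \<gamma>\<^sup>2 / (512 * (real m)\<^sup>2)))
            \<le> real (p ^ m * p) * (2 * exp (- real M * \<gamma>\<^sup>2 / (512 * (real m)\<^sup>2)))"
          by (rule mult_right_mono) auto
        also note M\<gamma>
        finally show "real (card (admissible_inputs p m) * p) *
            (2 * exp (- real M * (\<gamma> / 8)\<^sup>2 / (4 * (2 * (real m)\<^sup>2)))) < 1"
          by (simp add: power_divide)
      qed (use \<gamma> m admissible_inputs_nonneg admissible_inputs_sum in auto)
      have "(sqrt (real p) + 2) * real m / real K \<le> \<gamma> / 8"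
        using K\<gamma> K by (simp add: field_simps)
      then have close: "score p d W V x k / (s * F) - \<gamma> / 4 < code_score p K c x k
          \<and> code_score p K c x k < score p d W V x k / (s * F) + \<gamma> / 4"
        if "x \<in> admissible_inputs p m" "k < p" for x k
        using approx[OF that] unfolding abs_less_iff by argo
      have "set S \<inter> E c = {}"
      proof (rule ccontr)
        assume "set S \<inter> E c \<noteq> {}"
        then obtain x y k where xy: "(x, y) \<in> set S" and k: "k < p" "k \<noteq> y"
          and bad: "code_score p K c x y - code_score p K c x k < \<gamma> / 2"
          by (auto simp: E_def)
        have D: "(x, y) \<in> set_pmf ?D"
          using S xy by (auto simp: train_dist_def set_replicate_pmf in_lists_conv_set)
        note x = set_data_dist[OF p0 D]
        have "train_margin p d W V S \<le> score p d W V x y - score p d W V x k"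
          using train_margin_le[OF xy] margin_le[OF k] order_trans by blast
        then have "train_margin p d W V S / (s * F) \<le> score p d W V x y / (s * F) - score p d W V x k / (s * F)"
          unfolding diff_divide_distrib[symmetric] using s F by (intro divide_right_mono) auto
        moreover have "\<gamma> \<le> train_margin p d W V S / (s * F)" using ratio by (simp add: s_def F_def)
        ultimately have "\<gamma> \<le> score p d W V x y / (s * F) - score p d W V x k / (s * F)"
          by (rule order_trans[rotated])
        with bad show False
          using close[OF x] close[OF x(1) k(1)] by argo
      qed
      with good c have PE: "measure_pmf.prob ?D (E c) \<le> \<epsilon>" by (auto simp: G_def)
      have "test_error p m d W V \<le> measure_pmf.prob ?D (E c)"
        unfolding test_error_def
      proof (rule measure_pmf.finite_measure_mono_AE)
        show "AE xy in measure_pmf ?D. xy \<in> {(x, y). predict p d W V x \<noteq> Some y} \<longrightarrow> xy \<in> E c"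
        proof (subst AE_measure_pmf_iff, safe)
          fix x y assume D: "(x, y) \<in> set_pmf ?D" and wrong: "predict p d W V x \<noteq> Some y"
          note x = set_data_dist[OF p0 D]
          obtain k where k: "k < p" "k \<noteq> y" "score p d W V x y \<le> score p d W V x k"
            using predict_wrong[OF x(2) wrong] .
          have "score p d W V x y / (s * F) \<le> score p d W V x k / (s * F)"
            using k s F by (intro divide_right_mono) auto
          then have "code_score p K c x y - code_score p K c x k < \<gamma> / 2"
            using close[OF x] close[OF x(1) k(1)] by argo
          then show "(x, y) \<in> E c" using k by (auto simp: E_def)
        qed
      qed simp
      with PE show "test_error p m d W V \<le> \<epsilon>" by linarith
    qed
  qed simp
  finally show ?thesis .
qed

section \<open>Choice of the parameters and the final rate\<close>

theorem mainTheorem7: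
  fixes c :: real
  assumes "c > 0"
  shows "\<exists>C k::real. \<forall>(p::nat) (m::nat) (n::nat) (d::nat) (\<delta>::real).
     0 < m \<and> m < p \<and> m\<^sup>2 < n \<and> 17 \<le> n \<and>
     real d \<ge> 64 * real p * real m powr (real m / 2 + 2) * 4.67 ^ m \<and>
     0 < \<delta> \<and> \<delta> < 1 \<longrightarrow>
     measure_pmf.prob (train_dist p m n)
       {S. \<forall>W V. interpolating p d W V S \<and>
              train_margin p d W V S / (spectral_norm p d V * frobenius_norm d p W)
                \<ge> c * (1 / sqrt (real p)) * (1 / (real m powr (1.5 * real m + 2.5) * 6.34 ^ m))
            \<longrightarrow> test_error p m d W V
                \<le> C * (1 + ln (real n) + ln (1 / \<delta>)) powr k
                    * real p * real m powr (1.5 * real m + 2.5) * 6.34 ^ m * sqrt (real m / real n)}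
       \<ge> 1 - \<delta>"
proof -
  \<comment> \<open>Capping the constant at 1 secures \<open>\<gamma> * sqrt p \<le> 1\<close>
    below; lowering the margin threshold only enlarges the set of weights covered.\<close>
  define c0 where "c0 = min c 1"
  have c0: "0 < c0" "c0 \<le> 1" "c0 \<le> c" using assms by (auto simp: c0_def)
  define C1 where "C1 = 2 * (1536 / c0\<^sup>2 + 2) * (ln (75 / c0) + 2)"
  have ln75: "0 \<le> ln (75 / c0)" using c0 by (intro ln_ge_zero) (simp add: field_simps)
  have C1: "0 \<le> C1" unfolding C1_def using c0 ln75 by (intro mult_nonneg_nonneg add_nonneg_nonneg) auto
  \<comment> \<open>The extra 1 absorbs \<open>ln (1 / \<delta>)\<close> and gives
    \<open>C \<ge> 1\<close> for the trivial range.\<close>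
  define C where "C = C1 + 1"
  have bound: "measure_pmf.prob (train_dist p m n)
       {S. \<forall>W V. interpolating p d W V S \<and>
              train_margin p d W V S / (spectral_norm p d V * frobenius_norm d p W)
                \<ge> c * (1 / sqrt (real p)) * (1 / (real m powr (1.5 * real m + 2.5) * 6.34 ^ m))
            \<longrightarrow> test_error p m d W V
                \<le> C * (1 + ln (real n) + ln (1 / \<delta>)) powr 5
                    * real p * real m powr (1.5 * real m + 2.5) * 6.34 ^ m * sqrt (real m / real n)}
       \<ge> 1 - \<delta>" (is "_ \<le> measure_pmf.prob _ ?goal")
    if m: "0 < m" and mp: "m < p" and n: "17 \<le> n" and \<delta>: "0 < \<delta>" "\<delta> < 1"
    for p m n d :: nat and \<delta> :: real
  proof -
    define B where "B = real m powr (1.5 * real m + 2.5) * 6.34 ^ m"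
    define L where "L = ln (real n)"
    define \<Lambda> where "\<Lambda> = 1 + ln (real n) + ln (1 / \<delta>)"
    define z where "z = real p * B * sqrt (real m / real n)"
    have p2: "2 \<le> p" using m mp by simp
    have L0: "0 \<le> L" using n by (simp add: L_def)
    have ln\<delta>: "0 \<le> ln (1 / \<delta>)" using \<delta> by (intro ln_ge_zero) simp
    have \<Lambda>: "1 \<le> \<Lambda>" "L \<le> \<Lambda>" "ln (1 / \<delta>) \<le> \<Lambda>" using L0 ln\<delta> by (auto simp: \<Lambda>_def L_def)
    have pow: "1 \<le> real m powr (1.5 * real m + 2.5)"
      using m by (intro ge_one_powr_ge_zero) auto
    \<comment> \<open>Since \<open>6.34\<close> exceeds Euler's number, a polynomial bound on
      \<open>B\<close> in \<open>n\<close> forces \<open>m\<close> to be logarithmic in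
      \<open>n\<close>.\<close>
    have expB: "exp (real m) \<le> B"
    proof -
      have "exp (real m) = exp 1 ^ m" by (simp add: exp_of_nat_mult[symmetric])
      also have "\<dots> \<le> 6.34 ^ m" using exp_le by (intro power_mono) (auto intro: order_trans)
      also have "\<dots> \<le> B" unfolding B_def using mult_right_mono[OF pow, of "6.34 ^ m"] by simp
      finally show ?thesis .
    qed
    have B1: "1 \<le> B" using expB exp_ge_add_one_self[of "real m"] by linarith
    have z0: "0 \<le> z" using B1 by (simp add: z_def)
    have rhs: "C * (1 + ln (real n) + ln (1 / \<delta>)) powr 5
        * real p * real m powr (1.5 * real m + 2.5) * 6.34 ^ m * sqrt (real m / real n) = C * \<Lambda> ^ 5 * z"
      using \<Lambda>(1) powr_realpow[of \<Lambda> 5] by (simp add: z_def B_def \<Lambda>_def[symmetric])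
    show ?thesis
    \<comment> \<open>\<open>z\<close> is the target rate without logarithms. If it is at least 1
      the bound exceeds every probability.\<close>
    proof (cases "1 \<le> z")
      case True
      have "test_error p m d W V \<le> C * \<Lambda> ^ 5 * z" for W V
      proof -
        have "1 * 1 * 1 \<le> C * \<Lambda> ^ 5 * z"
          using C1 True \<Lambda>(1) by (intro mult_mono) (auto simp: C_def)
        moreover have "test_error p m d W V \<le> 1" by (simp add: test_error_def)
        ultimately show ?thesis by linarith
      qed
      then have "?goal = UNIV" unfolding rhs by auto
      then show ?thesis using \<delta> by simp
    next
      case False
      define \<gamma> where "\<gamma> = c0 / (sqrt (real p) * B)"
      \<comment> \<open>Rounding needs \<open>K \<ge> 8 * (sqrt p + 2) * m / \<gamma>\<close>. The
        \<open>24\<close> comes from \<open>sqrt p + 2 \<le> 3 * p\<close>, and the exact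
        \<open>p ^ (3/2)\<close> is relaxed to \<open>p\<^sup>2\<close>.\<close>
      define K where "K = nat \<lceil>24 * (real p)\<^sup>2 * real m * B / c0\<rceil>"
      \<comment> \<open>The leading factor is \<open>512 * m\<^sup>2 / \<gamma>\<^sup>2\<close>, and
        the logarithm pays for the union bound over inputs and labels; the final \<open>+ 1\<close>
        makes the inequality strict.\<close>
      define M where "M = nat \<lceil>512 * (real m)\<^sup>2 * real p * B\<^sup>2 / c0\<^sup>2 * ln (2 * real p ^ (m + 1))\<rceil> + 1"
      define Lg where "Lg = real (2 * p * M) * ln (real (2 * (p * K) + 1))"
      \<comment> \<open>Chosen so that the number of codes, \<open>exp Lg\<close>, times
        \<open>exp (- \<epsilon> * n)\<close> equals \<open>\<delta>\<close>.\<close>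
      define \<epsilon> where "\<epsilon> = (Lg + ln (1 / \<delta>)) / real n"
      have n0: "0 < real n" using n by simp
      have p1: "1 \<le> real p" "0 < real p" and m1: "1 \<le> real m" using p2 m by auto
      have z2: "z\<^sup>2 = (real p)\<^sup>2 * B\<^sup>2 * real m / real n"
        by (simp add: z_def power_mult_distrib)
      have "z\<^sup>2 \<le> z * 1" unfolding power2_eq_square using False z0 by (intro mult_left_mono) auto
      then have z2z: "z\<^sup>2 \<le> z" by simp
      with False have "z\<^sup>2 < 1" by linarith
      \<comment> \<open>From here \<open>p\<close> and \<open>B\<close> are at most
        \<open>n\<close>, so their logarithms are at most \<open>L\<close>, and so is
        \<open>m\<close>.\<close>
      then have big: "(real p)\<^sup>2 * B\<^sup>2 * real m < real n" using n0 by (simp add: z2)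
      have B2: "B \<le> B\<^sup>2" using B1 by (simp add: power2_eq_square)
      have pp: "real p \<le> (real p)\<^sup>2" using p1 by (simp add: power2_eq_square)
      have p2m: "(real p)\<^sup>2 * real m * B \<le> real n"
      proof -
        have "(real p)\<^sup>2 * real m * B \<le> (real p)\<^sup>2 * real m * B\<^sup>2" using B2 by (intro mult_left_mono) auto
        then show ?thesis using big by (simp add: mult.commute mult.left_commute)
      qed
      have pn: "real p \<le> real n"
      proof -
        have "real p * (1 * 1) \<le> (real p)\<^sup>2 * (real m * B)" using pp m1 B1 by (intro mult_mono) auto
        then show ?thesis using p2m by (simp add: mult.assoc)
      qed
      have Bn: "B \<le> real n"
      proof -
        have "1 * 1 * B \<le> (real p)\<^sup>2 * real m * B" using pp p1 m1 B1 by (intro mult_mono) auto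
        then show ?thesis using p2m by simp
      qed
      have mL: "real m \<le> L" unfolding L_def using expB Bn n0 by (subst ln_ge_iff) auto
      have ln2p: "ln (2 * real p ^ (m + 1)) \<le> 3 * L\<^sup>2"
      proof -
        have lnp: "ln (real p) \<le> L" unfolding L_def using pn p1 by simp
        have "ln (2 * real p ^ (m + 1)) \<le> ln (real p ^ (m + 2))"
          using p2 by (subst ln_le_cancel_iff) auto
        also have "\<dots> = (real m + 2) * ln (real p)"
          by (subst ln_realpow) (use p1 in auto)
        also have "\<dots> \<le> (3 * L) * L"
          using lnp mL m1 p1 by (intro mult_mono) auto
        finally show ?thesis by (simp add: power2_eq_square)
      qed
      have ln2p0: "0 \<le> ln (2 * real p ^ (m + 1))"
        using one_le_power[OF p1(1), of "m + 1"] by (intro ln_ge_zero) linarith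
      have K_ge: "24 * (real p)\<^sup>2 * real m * B / c0 \<le> real K" unfolding K_def by linarith
      have "1 * 1 * 1 \<le> (real p)\<^sup>2 * real m * B"
        using one_le_power[OF p1(1), of 2] m1 B1 by (intro mult_mono) auto
      then have "c0 \<le> 24 * (real p)\<^sup>2 * real m * B"
        using c0 by linarith
      then have K_arg: "1 \<le> 24 * (real p)\<^sup>2 * real m * B / c0"
        using c0 by (simp add: pos_le_divide_eq)
      then have K1: "1 \<le> K" using K_ge by linarith
      have K_le: "real K \<le> 25 * real n / c0"
      proof -
        have "real K \<le> 24 * (real p)\<^sup>2 * real m * B / c0 + 1"
          unfolding K_def using K_arg by linarith
        also have "\<dots> \<le> 24 * real n / c0 + real n / c0"
        proof (rule add_mono)
          show "24 * (real p)\<^sup>2 * real m * B / c0 \<le> 24 * real n / c0"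
            using p2m c0 by (intro divide_right_mono) auto
          show "1 \<le> real n / c0" using c0 n by (simp add: field_simps)
        qed
        finally show ?thesis by (simp add: field_simps)
      qed
      \<comment> \<open>Here \<open>75\<close> is \<open>3 * 25\<close>, and
        \<open>n\<^sup>2\<close> arises as the bounds for \<open>p\<close> and \<open>K\<close> are
        each linear in \<open>n\<close>.\<close>
      have lnK: "ln (real (2 * (p * K) + 1)) \<le> (ln (75 / c0) + 2) * \<Lambda>"
      proof -
        have "1 * 1 \<le> real p * real K" using p1 K1 by (intro mult_mono) auto
        then have "real (2 * (p * K) + 1) \<le> 3 * (real p * real K)"
          by (simp add: mult.commute)
        also have "\<dots> \<le> 3 * (real n * (25 * real n / c0))"
          using pn K_le by (intro mult_left_mono mult_mono) auto
        finally have "ln (real (2 * (p * K) + 1)) \<le> ln (75 / c0 * (real n)\<^sup>2)"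
          using n0 c0 by (subst ln_le_cancel_iff)
            (auto simp: power2_eq_square mult.commute mult.left_commute intro!: add_pos_nonneg)
        also have "\<dots> = ln (75 / c0) * 1 + 2 * L"
          using n0 c0 by (subst ln_mult) (auto simp: ln_realpow L_def)
        also have "\<dots> \<le> ln (75 / c0) * \<Lambda> + 2 * \<Lambda>"
          using ln75 \<Lambda> by (intro add_mono mult_left_mono) auto
        finally show ?thesis by (simp add: algebra_simps)
      qed
      have M_gt: "512 * (real m)\<^sup>2 * real p * B\<^sup>2 / c0\<^sup>2 * ln (2 * real p ^ (m + 1)) < real M"
        unfolding M_def by linarith
      have M_le: "real M \<le> real p * B\<^sup>2 * \<Lambda> ^ 4 * (1536 / c0\<^sup>2 + 2)"
      proof -
        have "real M \<le> 512 * (real m)\<^sup>2 * real p * B\<^sup>2 / c0\<^sup>2 * ln (2 * real p ^ (m + 1)) + 2"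
          unfolding M_def using ln2p0 by (simp add: of_nat_nat) linarith
        also have "\<dots> \<le> real p * B\<^sup>2 * \<Lambda> ^ 4 * (1536 / c0\<^sup>2) + 2 * (real p * B\<^sup>2 * \<Lambda> ^ 4)"
        proof (rule add_mono)
          \<comment> \<open>Source of four of the five powers of \<open>\<Lambda>\<close>: two from
            \<open>m\<^sup>2\<close>, two from the logarithm of the union bound. The fifth comes
            from \<open>lnK\<close>.\<close>
          have "(real m)\<^sup>2 * ln (2 * real p ^ (m + 1)) \<le> \<Lambda>\<^sup>2 * (3 * \<Lambda>\<^sup>2)"
          proof (intro mult_mono)
            show "(real m)\<^sup>2 \<le> \<Lambda>\<^sup>2" using mL \<Lambda> by (intro power_mono) auto
            have "L\<^sup>2 \<le> \<Lambda>\<^sup>2" using L0 \<Lambda> by (intro power_mono) auto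
            then show "ln (2 * real p ^ (m + 1)) \<le> 3 * \<Lambda>\<^sup>2" using ln2p by linarith
          qed (use ln2p0 in auto)
          then have "512 * real p * B\<^sup>2 / c0\<^sup>2 * ((real m)\<^sup>2 * ln (2 * real p ^ (m + 1)))
              \<le> 512 * real p * B\<^sup>2 / c0\<^sup>2 * (\<Lambda>\<^sup>2 * (3 * \<Lambda>\<^sup>2))"
            by (rule mult_left_mono) simp
          then show "512 * (real m)\<^sup>2 * real p * B\<^sup>2 / c0\<^sup>2 * ln (2 * real p ^ (m + 1))
              \<le> real p * B\<^sup>2 * \<Lambda> ^ 4 * (1536 / c0\<^sup>2)"
            by (simp add: field_simps power_add[symmetric] power2_eq_square power4_eq_xxxx)
          have "1 * 1 * 1 \<le> real p * B\<^sup>2 * \<Lambda> ^ 4"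
            using p1 B1 B2 \<Lambda>(1) by (intro mult_mono) auto
          then show "2 \<le> 2 * (real p * B\<^sup>2 * \<Lambda> ^ 4)" by linarith
        qed
        finally show ?thesis by (simp add: algebra_simps)
      qed
      have \<epsilon>_le: "\<epsilon> \<le> C * \<Lambda> ^ 5 * z"
      proof -
        define Q where "Q = (real p)\<^sup>2 * B\<^sup>2"
        have "Lg \<le> (2 * real p * (real p * B\<^sup>2 * \<Lambda> ^ 4 * (1536 / c0\<^sup>2 + 2))) * ((ln (75 / c0) + 2) * \<Lambda>)"
          unfolding Lg_def
        proof (rule mult_mono[OF _ lnK])
          have "2 * real p * real M \<le> 2 * real p * (real p * B\<^sup>2 * \<Lambda> ^ 4 * (1536 / c0\<^sup>2 + 2))"
            by (rule mult_left_mono[OF M_le]) simp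
          then show "real (2 * p * M) \<le> 2 * real p * (real p * B\<^sup>2 * \<Lambda> ^ 4 * (1536 / c0\<^sup>2 + 2))"
            by simp
        qed (use \<Lambda>(1) c0 in auto)
        also have "\<dots> = C1 * \<Lambda> ^ 5 * Q"
          by (simp add: C1_def Q_def power2_eq_square power_numeral_reduce mult_ac)
        finally have 1: "Lg \<le> C1 * \<Lambda> ^ 5 * Q" .
        have "1 * 1 \<le> Q" unfolding Q_def using pp p1 B1 B2 by (intro mult_mono) auto
        moreover have "\<Lambda> ^ 1 \<le> \<Lambda> ^ 5" using \<Lambda>(1) by (intro power_increasing) auto
        ultimately have "\<Lambda> * 1 \<le> \<Lambda> ^ 5 * Q" using \<Lambda>(1) by (intro mult_mono) auto
        with 1 \<Lambda>(3) have "Lg + ln (1 / \<delta>) \<le> C1 * \<Lambda> ^ 5 * Q + \<Lambda> ^ 5 * Q" by linarith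
        also have "\<dots> = C * \<Lambda> ^ 5 * Q" by (simp add: C_def algebra_simps)
        \<comment> \<open>The factor \<open>m\<close> is inserted because \<open>Q * m / n\<close>
          is exactly \<open>z\<^sup>2\<close>; the bound of order \<open>z\<^sup>2\<close> is then
          weakened to \<open>z\<close>, as \<open>z < 1\<close>.\<close>
        also have "\<dots> \<le> C * \<Lambda> ^ 5 * (Q * real m)"
        proof (rule mult_left_mono)
          have "Q * 1 \<le> Q * real m"
            by (rule mult_left_mono[OF m1]) (simp add: Q_def)
          then show "Q \<le> Q * real m" by simp
        qed (use C1 \<Lambda>(1) in \<open>simp add: C_def\<close>)
        finally have "\<epsilon> \<le> C * \<Lambda> ^ 5 * (Q * real m) / real n"
          unfolding \<epsilon>_def by (rule divide_right_mono) simp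
        also have "\<dots> = C * \<Lambda> ^ 5 * z\<^sup>2" by (simp add: z2 Q_def)
        also have "\<dots> \<le> C * \<Lambda> ^ 5 * z"
          using z2z C1 \<Lambda>(1) by (intro mult_left_mono) (auto simp: C_def)
        finally show ?thesis .
      qed
      have "1 - \<delta> \<le> measure_pmf.prob (train_dist p m n)
         {S. \<forall>W V. \<gamma> \<le> train_margin p d W V S / (spectral_norm p d V * frobenius_norm d p W)
            \<longrightarrow> test_error p m d W V \<le> \<epsilon>}"
      proof (rule margin_generalization[OF p2 m _ K1])
        show "0 < n" "0 < M" using n by (simp_all add: M_def)
        show "0 < \<gamma>" using c0 p1 B1 by (simp add: \<gamma>_def)
        show "\<gamma> * sqrt (real p) \<le> 1"
          using c0 p1 B1 by (simp add: \<gamma>_def field_simps)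
        show "8 * (sqrt (real p) + 2) * real m \<le> \<gamma> * real K"
        proof -
          have sq1: "1 \<le> sqrt (real p)" using p1 by simp
          have sqp: "sqrt (real p) \<le> real p"
            using p1 pp by (intro real_le_lsqrt) auto
          have "8 * (sqrt (real p) + 2) * real m \<le> 24 * real p * real m"
            using sqp p1 by (intro mult_right_mono) auto
          also have "\<dots> \<le> 24 * real p * real m * sqrt (real p)"
            using mult_left_mono[OF sq1, of "24 * real p * real m"] by simp
          also have "\<dots> = \<gamma> * (24 * (real p)\<^sup>2 * real m * B / c0)"
            using c0 p1 B1 by (simp add: \<gamma>_def field_simps power2_eq_square)
          also have "\<dots> \<le> \<gamma> * real K"
            using K_ge c0 B1 by (intro mult_left_mono) (auto simp: \<gamma>_def)
          finally show ?thesis .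
        qed
        show "real (p ^ m * p) * (2 * exp (- real M * \<gamma>\<^sup>2 / (512 * (real m)\<^sup>2))) < 1"
        proof -
          have pos: "0 < 2 * real p ^ (m + 1)" using p1 by simp
          have "ln (2 * real p ^ (m + 1)) < real M / (512 * (real m)\<^sup>2 * real p * B\<^sup>2 / c0\<^sup>2)"
            using M_gt c0 m p1 B1 by (subst pos_less_divide_eq) (auto simp: mult.commute)
          also have "\<dots> = real M * \<gamma>\<^sup>2 / (512 * (real m)\<^sup>2)"
            using c0 m p1 B1 by (simp add: \<gamma>_def power_divide power_mult_distrib)
          finally have "2 * real p ^ (m + 1) < exp (real M * \<gamma>\<^sup>2 / (512 * (real m)\<^sup>2))"
            using pos by (metis exp_less_cancel_iff exp_ln)
          then show ?thesis by (simp add: exp_minus field_simps)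
        qed
        show "real ((2 * (p * K) + 1) ^ (2 * p * M)) * exp (- \<epsilon> * real n) \<le> \<delta>"
        proof -
          have "real ((2 * (p * K) + 1) ^ (2 * p * M)) = exp Lg"
            unfolding Lg_def exp_of_nat_mult by (subst exp_ln) (auto intro: add_pos_nonneg)
          moreover have "- \<epsilon> * real n = - Lg + ln \<delta>"
            using n0 \<delta> by (simp add: \<epsilon>_def ln_div)
          ultimately show ?thesis using \<delta> by (simp add: exp_diff)
        qed
      qed
      also have "\<dots> \<le> measure_pmf.prob (train_dist p m n) ?goal"
      proof (rule measure_pmf.finite_measure_mono)
        have "\<gamma> \<le> c * (1 / sqrt (real p)) * (1 / B)"
          using c0 p1 B1 by (simp add: \<gamma>_def divide_right_mono)
        then show "{S. \<forall>W V. \<gamma> \<le> train_margin p d W V S / (spectral_norm p d V * frobenius_norm d p W)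
            \<longrightarrow> test_error p m d W V \<le> \<epsilon>} \<subseteq> ?goal"
          using \<epsilon>_le unfolding rhs B_def[symmetric] by (auto intro: order_trans)
      qed simp
      finally show ?thesis .
    qed
  qed
  show ?thesis
    by (intro exI[of _ C] exI[of _ 5] allI impI bound) auto
qed

end
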